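(* In the setting of the context, let $\tau=(\tau_n)_{n\in\mathbb{N}}$ be a sequence of positive times increasing without bound, let $u^0\in\mathfrak{U}$ be a $\tau$-strictly optimal control with trajectory $x^0$, and let $(\lambda^0,\psi^0)$ be a strictly $\tau$-vanishing solution of the maximum principle relations (adjoint equation), (maximum condition) that also satisfies the normalization condition. Suppose that the finite limit $I_*=\lim_{n\to\infty}I(\tau_n)$ exists. Then $\lambda^0=1$, $\psi^0(0)=I_*$, and for all $T\in\mathbb{T}$ $$\psi^0(T)=\big(I_*-I(T)\big)A^{-1}(T)=\Big(I_*-\int_0^T\frac{\partial g}{\partial x}(t,x^0(t),u^0(t))\,A(t)\,dt\Big)A^{-1}(T).$$ If moreover the finite limit $\lim_{t\to\infty}I(t)$ exists, then for all $T\in\mathbb{T}$ $$\psi^0(T)=\Big(\int_T^\infty\frac{\partial g}{\partial x}(t,x^0(t),u^0(t))\,A(t)\,dt\Big)A^{-1}(T),$$ where the improper integral is understood as $\lim_{S\to\infty}\int_T^S$.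
   Context: Setting. $\mathbb{T}=[0,\infty)$; $\mathbb{X}$ and $\mathbb{U}$ are finite-dimensional Euclidean spaces; $U:\mathbb{T}\rightsquigarrow\mathbb{U}$ is a set-valued map that is compact-valued, locally integrally bounded (i.e. $\sup_{u\in U(t)}\|u\|$ is bounded by a locally integrable function of $t$), and has Borel measurable graph. The set $\mathfrak{U}$ of admissible controls consists of all Borel measurable, locally bounded selectors $u$ of $U$. The functions $f(t,x,u)\in\mathbb{X}$ and $g(t,x,u)\in\mathbb{R}$ and their derivatives in $x$ are Carathéodory maps (measurable in $t$, continuous in $(x,u)$), locally Lipschitz in $x$, and integrally bounded on compacts (for $x$ in a compact set and $u\in U(t)$ their norms are bounded by a locally integrable function of $t$). Moreover, there is a continuous function $M:\mathbb{T}\to\mathbb{T}$ with $\|f(t,x,u)\|\le M(t)(1+\|x\|)$ for all $t\in\mathbb{T}$, $u\in U(t)$, $x\in\mathbb{X}$. $AC(\mathbb{T},\mathbb{X})$ denotes the (locally) absolutely continuous functions from $\mathbb{T}$ to $\mathbb{X}$. Problem. A point $x_*\in\mathbb{X}$ is fixed. Each $u\in\mathfrak{U}$ generates the trajectory $x$ solving $\dot x(t)=f(t,x(t),u(t))$ for a.e. $t\in\mathbb{T}$, $x(0)=x_*$ (the right end is free). For $T\ge 0$ put $J[u](T)=\int_0^T g(t,x(t),u(t))\,dt$; this is to be maximized as $T\to\infty$. Strict optimality. For a sequence $\tau=(\tau_n)$ of times increasing without bound, $u^0\in\mathfrak{U}$ is called $\tau$-strictly optimal if $J[u^0](\tau_n)\ge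 J[u](\tau_n)$ for all $n\in\mathbb{N}$ and all $u\in\mathfrak{U}$. Maximum principle relations. Let $\mathcal{H}(x,t,u,\lambda,\psi)=\psi f(t,x,u)+\lambda g(t,x,u)$, where $\psi\in\mathbb{X}$ is treated as a row vector. For the pair $(x^0,u^0)$ and $(\lambda,\psi)$ with $\lambda\in[0,1]$, $\psi\in AC(\mathbb{T},\mathbb{X})$: (adjoint equation) $\dot\psi(t)=-\dfrac{\partial\mathcal{H}}{\partial x}(x^0(t),t,u^0(t),\lambda,\psi(t))$ for a.e. $t$; (maximum condition) $\sup_{p\in U(t)}\mathcal{H}(x^0(t),t,p,\lambda,\psi(t))=\mathcal{H}(x^0(t),t,u^0(t),\lambda,\psi(t))$ for a.e. $t$; (normalization condition) either $\lambda=1$, or $\lambda=0$ and $\|\psi(0)\|=1$. A nontrivial (i.e. $\neq(0,0)$) pair $(\lambda^0,\psi^0)$ satisfying the adjoint equation and the maximum condition on $\mathbb{T}$ is called strictly $\tau$-vanishing if there exist a subsequence $\tau'$ of $\tau$ and pairs $(\lambda^n,\psi^n)\in[0,1]\times AC(\mathbb{T},\mathbb{X})$ converging to $(\lambda^0,\psi^0)$ uniformly on every compact set, each satisfying the adjoint equation and the maximum condition on $[0,\tau'_n]$ and the condition $\psi^n(\tau'_n)=0$. The functions $A$ and $I$. Let $A(t)$ be the matrix solution of $\dot A(t)=\dfrac{\partial f}{\partial x}(t,x^0(t),u^0(t))A(t)$, $A(0)=E$ (identity), and for $T\in\mathbb{T}$ let $I(T)=\displaystyle\int_0^T\frac{\partial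 g}{\partial x}(t,x^0(t),u^0(t))\,A(t)\,dt$ (a row vector). *)

theory Defs
  imports "HOL-Analysis.Analysis"
begin

text \<open>
  The time axis \<open>[0,\<infinity>)\<close> is the set \<open>{0..}\<close> of reals; values of functions at negative times
  are irrelevant. Row vectors are elements of \<open>real ^ 'n\<close> acting by \<open>v*\<close>, and the row-by-column
  product is the inner product. \<open>integral\<close> is the Henstock-Kurzweil integral; for the
  absolutely integrable integrands occurring here it agrees with the Lebesgue integral.
\<close>

section \<open>Function classes on the time axis\<close>

definition locally_integrable :: "(real \<Rightarrow> real) \<Rightarrow> bool" where
  "locally_integrable b \<longleftrightarrow> (\<forall>T\<ge>0. b absolutely_integrable_on {0..T})"

text \<open>A division of its own union is a finite family of non-overlapping compact intervals;
  \<open>Inf K\<close> and \<open>Sup K\<close> are the end points of the interval \<open>K\<close>.\<close>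

definition abs_continuous_on_interval ::
    "real \<Rightarrow> real \<Rightarrow> (real \<Rightarrow> 'a::real_normed_vector) \<Rightarrow> bool" where
  "abs_continuous_on_interval a b h \<longleftrightarrow>
     (\<forall>\<epsilon>>0. \<exists>\<delta>>0. \<forall>d. d division_of \<Union>d \<and> \<Union>d \<subseteq> {a..b} \<and> (\<Sum>K\<in>d. Sup K - Inf K) < \<delta>
        \<longrightarrow> (\<Sum>K\<in>d. norm (h (Sup K) - h (Inf K))) < \<epsilon>)"

definition locally_AC :: "(real \<Rightarrow> 'a::real_normed_vector) \<Rightarrow> bool" where
  "locally_AC h \<longleftrightarrow> (\<forall>T\<ge>0. abs_continuous_on_interval 0 T h)"

section \<open>Derivatives in the state variable\<close>

definition gradient :: "('a::real_inner \<Rightarrow> real) \<Rightarrow> 'a \<Rightarrow> 'a" where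
  "gradient h x = (THE D. GDERIV h x :> D)"

definition f_x :: "(real \<Rightarrow> real^'n \<Rightarrow> 'u \<Rightarrow> real^'n) \<Rightarrow> real \<Rightarrow> real^'n \<Rightarrow> 'u \<Rightarrow> real^'n^'n" where
  "f_x f t x u = jacobian (\<lambda>y. f t y u) (at x)"

definition g_x :: "(real \<Rightarrow> real^'n \<Rightarrow> 'u \<Rightarrow> real) \<Rightarrow> real \<Rightarrow> real^'n \<Rightarrow> 'u \<Rightarrow> real^'n" where
  "g_x g t x u = gradient (\<lambda>y. g t y u) x"

section \<open>Standing assumptions\<close>

definition control_constraint :: "(real \<Rightarrow> 'u::euclidean_space set) \<Rightarrow> bool" where
  "control_constraint U \<longleftrightarrow>
     (\<forall>t\<ge>0. compact (U t)) \<and>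
     (\<exists>b. locally_integrable b \<and> (\<forall>t\<ge>0. \<forall>u\<in>U t. norm u \<le> b t)) \<and>
     {(t, u). t \<ge> 0 \<and> u \<in> U t} \<in> sets borel"

definition caratheodory ::
    "(real \<Rightarrow> 'x::euclidean_space \<Rightarrow> 'u::euclidean_space \<Rightarrow> 'y::euclidean_space) \<Rightarrow> bool" where
  "caratheodory h \<longleftrightarrow>
     (\<forall>x u. (\<lambda>t. h t x u) \<in> borel_measurable (lebesgue_on {0..})) \<and>
     (\<forall>t\<ge>0. continuous_on UNIV (\<lambda>(x, u). h t x u))"

definition locally_lipschitz_in_state ::
    "(real \<Rightarrow> 'x::euclidean_space \<Rightarrow> 'u::euclidean_space \<Rightarrow> 'y::euclidean_space) \<Rightarrow> bool" where
  "locally_lipschitz_in_state h \<longleftrightarrow>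
     (\<forall>t\<ge>0. \<forall>u x. \<exists>r>0. \<exists>L. L-lipschitz_on (ball x r) (\<lambda>y. h t y u))"

definition integrally_bounded_on_compacts ::
    "(real \<Rightarrow> 'u::euclidean_space set) \<Rightarrow>
     (real \<Rightarrow> 'x::euclidean_space \<Rightarrow> 'u \<Rightarrow> 'y::euclidean_space) \<Rightarrow> bool" where
  "integrally_bounded_on_compacts U h \<longleftrightarrow>
     (\<forall>K. compact K \<longrightarrow>
        (\<exists>b. locally_integrable b \<and> (\<forall>t\<ge>0. \<forall>x\<in>K. \<forall>u\<in>U t. norm (h t x u) \<le> b t)))"

definition regular_map ::
    "(real \<Rightarrow> 'u::euclidean_space set) \<Rightarrow>
     (real \<Rightarrow> 'x::euclidean_space \<Rightarrow> 'u \<Rightarrow> 'y::euclidean_space) \<Rightarrow> bool" where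
  "regular_map U h \<longleftrightarrow>
     caratheodory h \<and> locally_lipschitz_in_state h \<and> integrally_bounded_on_compacts U h"

definition linear_growth ::
    "(real \<Rightarrow> 'u::euclidean_space set) \<Rightarrow> (real \<Rightarrow> real^'n \<Rightarrow> 'u \<Rightarrow> real^'n) \<Rightarrow> bool" where
  "linear_growth U f \<longleftrightarrow>
     (\<exists>M. continuous_on {0..} M \<and> (\<forall>t\<ge>0. M t \<ge> 0) \<and>
        (\<forall>t\<ge>0. \<forall>u\<in>U t. \<forall>x. norm (f t x u) \<le> M t * (1 + norm x)))"

definition standing_assumptions ::
    "(real \<Rightarrow> 'u::euclidean_space set) \<Rightarrow> (real \<Rightarrow> real^'n \<Rightarrow> 'u \<Rightarrow> real^'n) \<Rightarrow>
     (real \<Rightarrow> real^'n \<Rightarrow> 'u \<Rightarrow> real) \<Rightarrow> bool" where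
  "standing_assumptions U f g \<longleftrightarrow>
     control_constraint U \<and>
     (\<forall>t\<ge>0. \<forall>x u. (\<lambda>y. f t y u) differentiable (at x) \<and> (\<lambda>y. g t y u) differentiable (at x)) \<and>
     regular_map U f \<and> regular_map U g \<and> regular_map U (f_x f) \<and> regular_map U (g_x g) \<and>
     linear_growth U f"

section \<open>Controls, trajectories, optimality\<close>

definition admissible_controls ::
    "(real \<Rightarrow> 'u::euclidean_space set) \<Rightarrow> (real \<Rightarrow> 'u) set" where
  "admissible_controls U =
     {u. u \<in> borel_measurable (restrict_space borel {0..}) \<and>
         (\<forall>T\<ge>0. bounded (u ` {0..T})) \<and> (\<forall>t\<ge>0. u t \<in> U t)}"

definition trajectory ::
    "(real \<Rightarrow> real^'n \<Rightarrow> 'u \<Rightarrow> real^'n) \<Rightarrow> real^'n \<Rightarrow> (real \<Rightarrow> 'u) \<Rightarrow> (real \<Rightarrow> real^'n) \<Rightarrow> bool" where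
  "trajectory f xs u x \<longleftrightarrow>
     locally_AC x \<and> x 0 = xs \<and>
     (AE t in lebesgue. t \<ge> 0 \<longrightarrow> (x has_vector_derivative f t (x t) (u t)) (at t))"

text \<open>The payoff \<open>J[u](T)\<close>, with the trajectory \<open>x\<close> of \<open>u\<close> as an explicit argument.\<close>

definition payoff ::
    "(real \<Rightarrow> real^'n \<Rightarrow> 'u \<Rightarrow> real) \<Rightarrow> (real \<Rightarrow> real^'n) \<Rightarrow> (real \<Rightarrow> 'u) \<Rightarrow> real \<Rightarrow> real" where
  "payoff g x u T = integral {0..T} (\<lambda>t. g t (x t) (u t))"

definition strictly_optimal ::
    "(real \<Rightarrow> 'u::euclidean_space set) \<Rightarrow> (real \<Rightarrow> real^'n \<Rightarrow> 'u \<Rightarrow> real^'n) \<Rightarrow>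
     (real \<Rightarrow> real^'n \<Rightarrow> 'u \<Rightarrow> real) \<Rightarrow> real^'n \<Rightarrow> (nat \<Rightarrow> real) \<Rightarrow> (real \<Rightarrow> 'u) \<Rightarrow> bool" where
  "strictly_optimal U f g xs \<tau> u0 \<longleftrightarrow>
     u0 \<in> admissible_controls U \<and>
     (\<forall>x0 u x n. trajectory f xs u0 x0 \<and> u \<in> admissible_controls U \<and> trajectory f xs u x
        \<longrightarrow> payoff g x0 u0 (\<tau> n) \<ge> payoff g x u (\<tau> n))"

section \<open>Relations of the maximum principle\<close>

definition hamiltonian ::
    "(real \<Rightarrow> real^'n \<Rightarrow> 'u \<Rightarrow> real^'n) \<Rightarrow> (real \<Rightarrow> real^'n \<Rightarrow> 'u \<Rightarrow> real) \<Rightarrow>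
     real^'n \<Rightarrow> real \<Rightarrow> 'u \<Rightarrow> real \<Rightarrow> real^'n \<Rightarrow> real" where
  "hamiltonian f g x t u l \<psi> = \<psi> \<bullet> f t x u + l * g t x u"

definition adjoint_equation ::
    "(real \<Rightarrow> real^'n \<Rightarrow> 'u \<Rightarrow> real^'n) \<Rightarrow> (real \<Rightarrow> real^'n \<Rightarrow> 'u \<Rightarrow> real) \<Rightarrow>
     (real \<Rightarrow> real^'n) \<Rightarrow> (real \<Rightarrow> 'u) \<Rightarrow> real set \<Rightarrow> real \<Rightarrow> (real \<Rightarrow> real^'n) \<Rightarrow> bool" where
  "adjoint_equation f g x0 u0 S l \<psi> \<longleftrightarrow>
     (AE t in lebesgue. t \<in> S \<longrightarrow>
        (\<psi> has_vector_derivative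
           - gradient (\<lambda>x. hamiltonian f g x t (u0 t) l (\<psi> t)) (x0 t)) (at t))"

definition maximum_condition ::
    "(real \<Rightarrow> 'u set) \<Rightarrow> (real \<Rightarrow> real^'n \<Rightarrow> 'u \<Rightarrow> real^'n) \<Rightarrow>
     (real \<Rightarrow> real^'n \<Rightarrow> 'u \<Rightarrow> real) \<Rightarrow>
     (real \<Rightarrow> real^'n) \<Rightarrow> (real \<Rightarrow> 'u) \<Rightarrow> real set \<Rightarrow> real \<Rightarrow> (real \<Rightarrow> real^'n) \<Rightarrow> bool" where
  "maximum_condition U f g x0 u0 S l \<psi> \<longleftrightarrow>
     (AE t in lebesgue. t \<in> S \<longrightarrow>
        (SUP p\<in>U t. hamiltonian f g (x0 t) t p l (\<psi> t)) = hamiltonian f g (x0 t) t (u0 t) l (\<psi> t))"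

definition normalization_condition :: "real \<Rightarrow> (real \<Rightarrow> real^'n) \<Rightarrow> bool" where
  "normalization_condition l \<psi> \<longleftrightarrow> l = 1 \<or> (l = 0 \<and> norm (\<psi> 0) = 1)"

definition mp_solution_on ::
    "(real \<Rightarrow> 'u set) \<Rightarrow> (real \<Rightarrow> real^'n \<Rightarrow> 'u \<Rightarrow> real^'n) \<Rightarrow>
     (real \<Rightarrow> real^'n \<Rightarrow> 'u \<Rightarrow> real) \<Rightarrow>
     (real \<Rightarrow> real^'n) \<Rightarrow> (real \<Rightarrow> 'u) \<Rightarrow> real set \<Rightarrow> real \<Rightarrow> (real \<Rightarrow> real^'n) \<Rightarrow> bool" where
  "mp_solution_on U f g x0 u0 S l \<psi> \<longleftrightarrow>
     l \<in> {0..1} \<and> locally_AC \<psi> \<and>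
     adjoint_equation f g x0 u0 S l \<psi> \<and> maximum_condition U f g x0 u0 S l \<psi>"

definition strictly_vanishing ::
    "(real \<Rightarrow> 'u set) \<Rightarrow> (real \<Rightarrow> real^'n \<Rightarrow> 'u \<Rightarrow> real^'n) \<Rightarrow>
     (real \<Rightarrow> real^'n \<Rightarrow> 'u \<Rightarrow> real) \<Rightarrow> (real \<Rightarrow> real^'n) \<Rightarrow> (real \<Rightarrow> 'u) \<Rightarrow> (nat \<Rightarrow> real) \<Rightarrow>
     real \<Rightarrow> (real \<Rightarrow> real^'n) \<Rightarrow> bool" where
  "strictly_vanishing U f g x0 u0 \<tau> l0 \<psi>0 \<longleftrightarrow>
     mp_solution_on U f g x0 u0 {0..} l0 \<psi>0 \<and>
     (l0 \<noteq> 0 \<or> (\<exists>t\<ge>0. \<psi>0 t \<noteq> 0)) \<and>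
     (\<exists>(r :: nat \<Rightarrow> nat) (l :: nat \<Rightarrow> real) (\<psi> :: nat \<Rightarrow> real \<Rightarrow> real^'n).
        strict_mono r \<and>
        (\<forall>n. mp_solution_on U f g x0 u0 {0..\<tau> (r n)} (l n) (\<psi> n) \<and> \<psi> n (\<tau> (r n)) = 0) \<and>
        l \<longlonglongrightarrow> l0 \<and>
        (\<forall>K. compact K \<and> K \<subseteq> {0..} \<longrightarrow> uniform_limit K \<psi> \<psi>0 sequentially))"

section \<open>The linearized system\<close>

definition fundamental_matrix ::
    "(real \<Rightarrow> real^'n \<Rightarrow> 'u \<Rightarrow> real^'n) \<Rightarrow> (real \<Rightarrow> real^'n) \<Rightarrow> (real \<Rightarrow> 'u) \<Rightarrow>
     (real \<Rightarrow> real^'n^'n) \<Rightarrow> bool" where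
  "fundamental_matrix f x0 u0 A \<longleftrightarrow>
     locally_AC A \<and> A 0 = mat 1 \<and>
     (AE t in lebesgue. t \<ge> 0 \<longrightarrow>
        (A has_vector_derivative f_x f t (x0 t) (u0 t) ** A t) (at t))"

definition I_fun ::
    "(real \<Rightarrow> real^'n \<Rightarrow> 'u \<Rightarrow> real) \<Rightarrow> (real \<Rightarrow> real^'n) \<Rightarrow> (real \<Rightarrow> 'u) \<Rightarrow>
     (real \<Rightarrow> real^'n^'n) \<Rightarrow> real \<Rightarrow> real^'n" where
  "I_fun g x0 u0 A T = integral {0..T} (\<lambda>t. g_x g t (x0 t) (u0 t) v* A t)"

end

(* Along any solution of the adjoint equation the row vector \<psi> A has derivative - \<lambda> (dg/dx) A,
   so \<psi>(T) A(T) = \<psi>(0) - \<lambda> I(T). For the approximating pairs \<psi>^n vanishes at \<tau>'_n, hence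
   \<psi>^n(0) = \<lambda>^n I(\<tau>'_n), and in the limit \<psi>^0(0) = \<lambda>^0 I_*. This excludes \<lambda>^0 = 0, because
   normalization would then require norm \<psi>^0(0) = 1. *)
theory Submission
  imports Defs
begin

section \<open>The fundamental theorem of calculus for absolutely continuous functions\<close>

text \<open>The exceptional set is null but possibly uncountable, so differentiability off
  \<open>N\<close> alone would not suffice; absolute continuity controls what \<open>h\<close> does
  on \<open>N\<close>. The proof works directly with gauges. At tags outside \<open>N\<close> the
  derivative approximates the increments of \<open>h\<close>, and at tags in \<open>N\<close> the
  increments have small total size.\<close>

lemma has_integral_if_abs_continuous:
  fixes h :: "real \<Rightarrow> 'a::banach"
  assumes ab: "a \<le> b"
    and AC: "abs_continuous_on_interval a b h"
    and N: "negligible N"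
    and deriv: "\<And>t. t \<in> {a..b} - N \<Longrightarrow> (h has_vector_derivative \<phi> t) (at t within {a..b})"
  shows "(\<phi> has_integral h b - h a) {a..b}"
proof (cases "a = b")
  case True
  then show ?thesis by (simp add: has_integral_refl)
next
  case False
  with ab have "a < b" by simp
  \<comment> \<open>With integrand 0 on \<open>N\<close>, the Riemann terms tagged there vanish and
    leave bare increments of \<open>h\<close>. Values on a null set do not affect the integral, so
    \<phi> can be restored at the end.\<close>
  have "((\<lambda>t. if t \<in> N then 0 else \<phi> t) has_integral h b - h a) {a..b}" (is "(?\<phi> has_integral _) _")
    unfolding has_integral_factor_content_real
  proof (intro allI impI)
    fix e :: real
    assume "e > 0"
    \<comment> \<open>Half of the tolerance is for tags outside \<open>N\<close>, half for tags in
      \<open>N\<close>.\<close>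
    define \<epsilon> where "\<epsilon> = e/2"
    have "\<epsilon> > 0" using \<open>e > 0\<close> by (simp add: \<epsilon>_def)
    have "\<epsilon> * (b - a) > 0" using \<open>\<epsilon> > 0\<close> \<open>a < b\<close> by simp
    then obtain \<delta> where "\<delta> > 0" and \<delta>: "\<And>d. \<lbrakk>d division_of \<Union>d; \<Union>d \<subseteq> {a..b};
        (\<Sum>K\<in>d. Sup K - Inf K) < \<delta>\<rbrakk> \<Longrightarrow> (\<Sum>K\<in>d. norm (h (Sup K) - h (Inf K))) < \<epsilon> * (b - a)"
      using AC unfolding abs_continuous_on_interval_def by meson
    obtain G where "open G" "N \<subseteq> G" and Gm: "G \<in> lmeasurable" and Gd: "measure lebesgue G < \<delta>"
    proof -
      have Ns: "N \<in> sets lebesgue" "emeasure lebesgue N = 0" "N \<in> lmeasurable"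
        using N negligible_imp_sets negligible_iff_emeasure0 negligible_imp_measurable by blast+
      obtain G where G: "open G" "N \<subseteq> G" "G - N \<in> lmeasurable" "emeasure lebesgue (G - N) < ennreal \<delta>"
        using sets_lebesgue_outer_open[OF Ns(1) \<open>\<delta> > 0\<close>] by blast
      have GN: "G = (G - N) \<union> N" using G(2) by auto
      have "G \<in> lmeasurable"
        by (subst GN) (intro fmeasurable.Un G Ns)
      moreover have "measure lebesgue (G - N) < \<delta>"
        using G(3,4) \<open>\<delta> > 0\<close> by (simp add: emeasure_eq_measure2 ennreal_less_iff)
      moreover have "measure lebesgue G \<le> measure lebesgue (G - N) + measure lebesgue N"
        using measure_Un_le[of "G - N" lebesgue N] G(3) Ns(1) GN by (metis fmeasurableD)
      ultimately show thesis
        using that G(1,2) negligible_imp_measure0[OF N] by simp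
    qed
    \<comment> \<open>The gauge keeps intervals tagged in \<open>N\<close> inside \<open>G\<close>; their total length is then below \<open>\<delta>\<close>,
      and absolute continuity bounds their contribution to the increment of \<open>h\<close>.\<close>
    have "\<exists>r>0. ball t r \<subseteq> G" if "t \<in> N" for t
      using that \<open>open G\<close> \<open>N \<subseteq> G\<close> by (meson openE subsetD)
    then obtain r where r: "\<And>t. t \<in> N \<Longrightarrow> r t > 0" "\<And>t. t \<in> N \<Longrightarrow> ball t (r t) \<subseteq> G"
      by metis
    have "\<exists>d>0. t \<in> {a..b} - N \<longrightarrow>
         (\<forall>y\<in>{a..b}. norm (y-t) < d \<longrightarrow> norm (h y - h t - (y-t) *\<^sub>R \<phi> t) \<le> \<epsilon> * norm (y-t))" for t
      using deriv[of t, unfolded has_vector_derivative_def has_derivative_within_alt] \<open>\<epsilon> > 0\<close>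
      by (meson zero_less_one)
    then obtain d where d: "\<And>t. 0 < d t"
        "\<And>t y. \<lbrakk>t \<in> {a..b} - N; y \<in> {a..b}; norm (y-t) < d t\<rbrakk>
            \<Longrightarrow> norm (h y - h t - (y-t) *\<^sub>R \<phi> t) \<le> \<epsilon> * norm (y-t)"
      by metis
    let ?\<gamma> = "\<lambda>t. ball t (if t \<in> N then r t else d t)"
    show "\<exists>\<gamma>. gauge \<gamma> \<and> (\<forall>p. p tagged_division_of {a..b} \<and> \<gamma> fine p \<longrightarrow>
        norm ((\<Sum>(x,K)\<in>p. measure lborel K *\<^sub>R ?\<phi> x) - (h b - h a)) \<le> e * measure lborel {a..b})"
    proof (intro exI conjI allI impI)
      show "gauge ?\<gamma>"
        using d(1) r(1) by (intro gauge_ball_dependent) simp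
    next
      fix p
      assume "p tagged_division_of {a..b} \<and> ?\<gamma> fine p"
      then have p: "p tagged_division_of {a..b}" and fine: "?\<gamma> fine p" by auto
      define q where "q = {(x,K) \<in> p. x \<in> N}"
      have qp: "q \<subseteq> p" by (auto simp: q_def)
      have finp: "finite p" using p by blast
      have length: "b - a = (\<Sum>(x,K)\<in>p. Sup K - Inf K)"
        and increment: "h b - h a = (\<Sum>(x,K)\<in>p. h (Sup K) - h (Inf K))"
        using additive_tagged_division_1[where f= "\<lambda>x. x"] additive_tagged_division_1[where f= h]
            \<open>a \<le> b\<close> p by auto
      have interval: "\<exists>u v. K = {u..v} \<and> u \<le> x \<and> x \<le> v \<and> a \<le> u \<and> v \<le> b \<and> Sup K = v \<and> Inf K = u"
        if "(x, K) \<in> p" for x K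
      proof -
        obtain u v where uv: "K = cbox u v"
          using tagged_division_ofD(4)[OF p \<open>(x, K) \<in> p\<close>] by blast
        moreover have "x \<in> K" "K \<subseteq> {a..b}"
          using p \<open>(x, K) \<in> p\<close> by blast+
        ultimately show ?thesis
          by (intro exI[of _ u] exI[of _ v]) auto
      qed
      have regular: "norm (measure lborel K *\<^sub>R ?\<phi> x - (h (Sup K) - h (Inf K))) \<le> \<epsilon> * (Sup K - Inf K)"
        if "(x, K) \<in> p - q" for x K
      proof -
        have "x \<notin> N" using that by (auto simp: q_def)
        obtain u v where K: "K = {u..v}" "u \<le> x" "x \<le> v" "a \<le> u" "v \<le> b" "Sup K = v" "Inf K = u"
          using interval \<open>(x, K) \<in> p - q\<close> by blast
        have "K \<subseteq> ball x (d x)"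
          using fine that \<open>x \<notin> N\<close> unfolding fine_def by force
        moreover have "u \<in> K" "v \<in> K" using K by auto
        ultimately have "u \<in> ball x (d x)" "v \<in> ball x (d x)" by blast+
        then have near: "norm (u - x) < d x" "norm (v - x) < d x"
          by (simp_all add: dist_real_def abs_minus_commute)
        \<comment> \<open>Straddle estimate: both end points are compared with the tag
          \<open>x\<close>. Since \<open>x\<close> lies between \<open>u\<close> and
          \<open>v\<close>, the two errors add up to a multiple of exactly
          \<open>v - u\<close>.\<close>
        have "norm ((v - u) *\<^sub>R \<phi> x - (h v - h u))
              = norm (h u - h x - (u - x) *\<^sub>R \<phi> x - (h v - h x - (v - x) *\<^sub>R \<phi> x))"
          by (auto simp: algebra_simps)
        also have "\<dots> \<le> norm (h u - h x - (u - x) *\<^sub>R \<phi> x) + norm (h v - h x - (v - x) *\<^sub>R \<phi> x)"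
          by (rule norm_triangle_ineq4)
        also have "\<dots> \<le> \<epsilon> * norm (u - x) + \<epsilon> * norm (v - x)"
          by (intro add_mono d(2)) (use K near \<open>x \<notin> N\<close> in auto)
        also have "\<dots> = \<epsilon> * (v - u)"
          using K by (simp add: algebra_simps)
        finally show ?thesis
          using K \<open>x \<notin> N\<close> by simp
      qed
      have ptd: "q tagged_division_of \<Union>(snd ` q)"
        using p qp by (intro tagged_partial_division_of_Union_self)
          (auto simp: tagged_division_of_def intro: tagged_partial_division_subset)
      have div: "(snd ` q) division_of \<Union>(snd ` q)"
        using division_of_tagged_division[OF ptd] .
      have "K \<subseteq> {a..b}" if "(x, K) \<in> p" for x K
        using tagged_division_ofD(3)[OF p that] .
      then have subab: "\<Union>(snd ` q) \<subseteq> {a..b}"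
        using qp by fastforce
      \<comment> \<open>The intervals tagged in \<open>N\<close> overlap only in null sets, so their
        total length is the measure of their union. This union lies in \<open>G\<close>, whose
        measure is below \<delta>.\<close>
      have "(\<Sum>K\<in>snd ` q. Sup K - Inf K) = (\<Sum>K\<in>snd ` q. measure lebesgue K)"
      proof (rule sum.cong[OF refl])
        fix K assume "K \<in> snd ` q"
        then obtain x where "(x, K) \<in> p" using qp by auto
        then obtain u v where "K = {u..v}" "u \<le> v" using interval by (meson order_trans)
        then show "Sup K - Inf K = measure lebesgue K" by simp
      qed
      also have "\<dots> = measure lebesgue (\<Union>(snd ` q))"
      proof (rule measure_negligible_finite_Union[symmetric])
        show "finite (snd ` q)" using finp qp finite_subset by blast
        show "K \<in> lmeasurable" if "K \<in> snd ` q" for K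
          using division_ofD(4)[OF div that] by auto
        show "pairwise (\<lambda>S T. negligible (S \<inter> T)) (snd ` q)"
          unfolding pairwise_def
        proof (intro ballI impI)
          fix K L assume KL: "K \<in> snd ` q" "L \<in> snd ` q" "K \<noteq> L"
          obtain u v where "K = cbox u v" using division_ofD(4)[OF div KL(1)] by blast
          moreover obtain u' v' where "L = cbox u' v'" using division_ofD(4)[OF div KL(2)] by blast
          ultimately have "K \<inter> L = {max u u'..min v v'}" by simp
          then obtain c d where cd: "K \<inter> L = {c..d}" by blast
          have "interior (K \<inter> L) = {}" using division_ofD(5)[OF div KL] by simp
          then show "negligible (K \<inter> L)"
            unfolding cd box_real(2)[symmetric] interior_cbox negligible_interval .
        qed
      qed
      also have "\<dots> \<le> measure lebesgue G"
      proof (rule measure_mono_fmeasurable[OF _ _ Gm])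
        show "\<Union>(snd ` q) \<subseteq> G"
        proof (rule Union_least)
          fix K assume "K \<in> snd ` q"
          then obtain x where x: "(x, K) \<in> p" "x \<in> N" by (auto simp: q_def)
          then have "K \<subseteq> ball x (r x)" using fineD[OF fine x(1)] by simp
          then show "K \<subseteq> G" using r(2)[OF x(2)] by blast
        qed
        show "\<Union>(snd ` q) \<in> sets lebesgue"
          using division_ofD(1,4)[OF div] by (intro sets.finite_Union) fastforce+
      qed
      finally have "(\<Sum>K\<in>snd ` q. Sup K - Inf K) < \<delta>" using Gd by simp
      then have "(\<Sum>K\<in>snd ` q. norm (h (Sup K) - h (Inf K))) < \<epsilon> * (b - a)"
        using \<delta> div subab by blast
      moreover have "(\<Sum>(x,K)\<in>q. norm (h (Sup K) - h (Inf K))) = (\<Sum>K\<in>snd ` q. norm (h (Sup K) - h (Inf K)))"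
      proof -
        \<comment> \<open>Absolute continuity sums over intervals, the tagged division over pairs.
          An interval occurring with two tags must be degenerate, so its increment is 0 and the sums
          agree. The empty interval gets the value 0 explicitly, because its \<open>Sup\<close> and
          \<open>Inf\<close> carry no information.\<close>
        let ?D = "\<lambda>K. if K = {} then 0 else norm (h (Sup K) - h (Inf K))"
        have "?D (cbox u v) = 0" if "box u v = {}" for u v :: real
          using that by (cases "u = v") auto
        then have "(\<Sum>(x,K)\<in>q. ?D K) = (\<Sum>K\<in>snd ` q. ?D K)"
          by (rule sum.over_tagged_division_lemma[OF ptd])
        moreover have "K \<noteq> {}" if "(x, K) \<in> q" for x K
          using tagged_division_ofD(2)[OF p, of x K] that qp by blast
        then have "(\<Sum>(x,K)\<in>q. ?D K) = (\<Sum>(x,K)\<in>q. norm (h (Sup K) - h (Inf K)))"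
          and "(\<Sum>K\<in>snd ` q. ?D K) = (\<Sum>K\<in>snd ` q. norm (h (Sup K) - h (Inf K)))"
          by (intro sum.cong refl; fastforce)+
        ultimately show ?thesis by simp
      qed
      ultimately have singular: "(\<Sum>(x,K)\<in>q. norm (h (Sup K) - h (Inf K))) \<le> \<epsilon> * (b - a)"
        by simp
      have "norm ((\<Sum>(x,K)\<in>p. measure lborel K *\<^sub>R ?\<phi> x) - (h b - h a))
          = norm (\<Sum>(x,K)\<in>p. measure lborel K *\<^sub>R ?\<phi> x - (h (Sup K) - h (Inf K)))"
        by (simp add: increment split_def sum_subtractf)
      also have "\<dots> \<le> (\<Sum>(x,K)\<in>p. norm (measure lborel K *\<^sub>R ?\<phi> x - (h (Sup K) - h (Inf K))))"
        unfolding split_def by (rule norm_sum)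
      also have "\<dots> = (\<Sum>(x,K)\<in>p - q. norm (measure lborel K *\<^sub>R ?\<phi> x - (h (Sup K) - h (Inf K))))
          + (\<Sum>(x,K)\<in>q. norm (measure lborel K *\<^sub>R ?\<phi> x - (h (Sup K) - h (Inf K))))"
        by (rule sum.subset_diff[OF qp finp])
      also have "(\<Sum>(x,K)\<in>q. norm (measure lborel K *\<^sub>R ?\<phi> x - (h (Sup K) - h (Inf K))))
          = (\<Sum>(x,K)\<in>q. norm (h (Sup K) - h (Inf K)))"
        by (intro sum.cong) (auto simp: q_def norm_minus_commute)
      also have "(\<Sum>(x,K)\<in>p - q. norm (measure lborel K *\<^sub>R ?\<phi> x - (h (Sup K) - h (Inf K))))
          \<le> (\<Sum>(x,K)\<in>p - q. \<epsilon> * (Sup K - Inf K))"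
        by (rule sum_mono) (use regular in auto)
      also have "\<dots> \<le> (\<Sum>(x,K)\<in>p. \<epsilon> * (Sup K - Inf K))"
      proof (rule sum_mono2[OF finp])
        show "0 \<le> (case z of (x,K) \<Rightarrow> \<epsilon> * (Sup K - Inf K))" if "z \<in> p - (p - q)" for z
          using interval[of "fst z" "snd z"] that \<open>\<epsilon> > 0\<close> by (auto simp: split_def)
      qed auto
      also have "\<dots> = \<epsilon> * (b - a)"
        by (simp add: length sum_distrib_left split_def)
      finally show "norm ((\<Sum>(x,K)\<in>p. measure lborel K *\<^sub>R ?\<phi> x) - (h b - h a)) \<le> e * measure lborel {a..b}"
        using singular ab by (simp add: \<epsilon>_def field_simps)
    qed
  qed
  then show ?thesis
    by (rule has_integral_spike[OF N, rotated]) auto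
qed

section \<open>Continuity and products of absolutely continuous functions\<close>

lemma abs_continuous_on_subinterval:
  assumes "abs_continuous_on_interval a b h" "{c..d} \<subseteq> {a..b}"
  shows "abs_continuous_on_interval c d h"
  using assms unfolding abs_continuous_on_interval_def by (meson order_trans)

lemma abs_continuous_on_const: "abs_continuous_on_interval a b (\<lambda>_. c)"
  unfolding abs_continuous_on_interval_def by (auto intro: exI[of _ 1])

lemma abs_continuous_on_imp_continuous_on:
  assumes "abs_continuous_on_interval a b h"
  shows "continuous_on {a..b} h"
  unfolding continuous_on_iff
proof (intro ballI allI impI)
  fix x \<epsilon> :: real
  assume x: "x \<in> {a..b}" and "\<epsilon> > 0"
  then obtain \<delta> where "\<delta> > 0" and \<delta>: "\<And>d. \<lbrakk>d division_of \<Union>d; \<Union>d \<subseteq> {a..b};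
        (\<Sum>K\<in>d. Sup K - Inf K) < \<delta>\<rbrakk> \<Longrightarrow> (\<Sum>K\<in>d. norm (h (Sup K) - h (Inf K))) < \<epsilon>"
    using assms unfolding abs_continuous_on_interval_def by meson
  show "\<exists>\<delta>>0. \<forall>y\<in>{a..b}. dist y x < \<delta> \<longrightarrow> dist (h y) (h x) < \<epsilon>"
  proof (intro exI[of _ \<delta>] conjI ballI impI \<open>\<delta> > 0\<close>)
    fix y assume y: "y \<in> {a..b}" and "dist y x < \<delta>"
    let ?d = "{{min x y..max x y}}"
    have div: "?d division_of \<Union>?d"
      using division_of_self[of "min x y" "max x y"] by simp
    have "(\<Sum>K\<in>?d. norm (h (Sup K) - h (Inf K))) < \<epsilon>"
      by (rule \<delta>[OF div]) (use x y \<open>dist y x < \<delta>\<close> in \<open>auto simp: dist_real_def\<close>)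
    then show "dist (h y) (h x) < \<epsilon>"
      by (cases "x \<le> y") (auto simp: dist_norm norm_minus_commute min_def max_def)
  qed
qed

text \<open>The increment of a product splits into one term per factor, and continuity bounds the
  factors on the compact interval. An abstract bilinear product covers both row vector times matrix,
  for \<open>\<psi> v* A\<close>, and matrix times column vector, for \<open>A *v v\<close>.\<close>

lemma (in bounded_bilinear) abs_continuous_on_interval:
  assumes p: "abs_continuous_on_interval a b p" and q: "abs_continuous_on_interval a b q"
  shows "abs_continuous_on_interval a b (\<lambda>t. prod (p t) (q t))"
  unfolding abs_continuous_on_interval_def
proof (intro allI impI)
  fix \<epsilon> :: real
  assume "\<epsilon> > 0"
  obtain P where P: "P > 0" "\<And>t. t \<in> {a..b} \<Longrightarrow> norm (p t) \<le> P"
    using compact_imp_bounded[OF compact_continuous_image[OF abs_continuous_on_imp_continuous_on[OF p] compact_Icc]]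
    by (auto simp: bounded_pos)
  obtain Q where Q: "Q > 0" "\<And>t. t \<in> {a..b} \<Longrightarrow> norm (q t) \<le> Q"
    using compact_imp_bounded[OF compact_continuous_image[OF abs_continuous_on_imp_continuous_on[OF q] compact_Icc]]
    by (auto simp: bounded_pos)
  obtain C where C: "C > 0" "\<And>x y. norm (prod x y) \<le> norm x * norm y * C"
    using pos_bounded by blast
  \<comment> \<open>The tolerances anticipate the weights \<open>C * Q\<close> and
    \<open>C * P\<close> of the two sums of increments, so that each weighted sum stays below half
    of \<epsilon>.\<close>
  have "\<epsilon> / (2 * C * Q) > 0" "\<epsilon> / (2 * C * P) > 0"
    using \<open>\<epsilon> > 0\<close> P(1) Q(1) C(1) by auto
  obtain \<delta>1 where "\<delta>1 > 0" and \<delta>1: "\<And>d. \<lbrakk>d division_of \<Union>d; \<Union>d \<subseteq> {a..b};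
        (\<Sum>K\<in>d. Sup K - Inf K) < \<delta>1\<rbrakk> \<Longrightarrow> (\<Sum>K\<in>d. norm (p (Sup K) - p (Inf K))) < \<epsilon> / (2 * C * Q)"
    using p \<open>\<epsilon> / (2 * C * Q) > 0\<close> unfolding abs_continuous_on_interval_def by meson
  obtain \<delta>2 where "\<delta>2 > 0" and \<delta>2: "\<And>d. \<lbrakk>d division_of \<Union>d; \<Union>d \<subseteq> {a..b};
        (\<Sum>K\<in>d. Sup K - Inf K) < \<delta>2\<rbrakk> \<Longrightarrow> (\<Sum>K\<in>d. norm (q (Sup K) - q (Inf K))) < \<epsilon> / (2 * C * P)"
    using q \<open>\<epsilon> / (2 * C * P) > 0\<close> unfolding abs_continuous_on_interval_def by meson
  show "\<exists>\<delta>>0. \<forall>d. d division_of \<Union>d \<and> \<Union>d \<subseteq> {a..b} \<and> (\<Sum>K\<in>d. Sup K - Inf K) < \<delta>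
      \<longrightarrow> (\<Sum>K\<in>d. norm (prod (p (Sup K)) (q (Sup K)) - prod (p (Inf K)) (q (Inf K)))) < \<epsilon>"
  proof (intro exI[of _ "min \<delta>1 \<delta>2"] conjI allI impI)
    fix d
    assume d: "d division_of \<Union>d \<and> \<Union>d \<subseteq> {a..b} \<and> (\<Sum>K\<in>d. Sup K - Inf K) < min \<delta>1 \<delta>2"
    have "norm (prod (p (Sup K)) (q (Sup K)) - prod (p (Inf K)) (q (Inf K)))
        \<le> C * P * norm (q (Sup K) - q (Inf K)) + C * Q * norm (p (Sup K) - p (Inf K))"
      if "K \<in> d" for K
    proof -
      obtain u v where K: "K = cbox u v" using d \<open>K \<in> d\<close> by (meson division_ofD(4))
      moreover have "K \<noteq> {}" "K \<subseteq> {a..b}" using d \<open>K \<in> d\<close> by (blast dest: division_ofD(3))+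
      ultimately have "Sup K = v" "Inf K = u" and uv: "u \<in> {a..b}" "v \<in> {a..b}" by auto
      have "prod (p v) (q v) - prod (p u) (q u) = prod (p v) (q v - q u) + prod (p v - p u) (q u)"
        by (simp add: diff_left diff_right)
      then have "norm (prod (p v) (q v) - prod (p u) (q u))
          \<le> norm (p v) * norm (q v - q u) * C + norm (p v - p u) * norm (q u) * C"
        by (metis C(2) add_mono norm_triangle_le)
      also have "\<dots> \<le> P * norm (q v - q u) * C + norm (p v - p u) * Q * C"
        by (intro add_mono mult_right_mono mult_left_mono P Q uv) (use C in auto)
      finally show ?thesis
        using \<open>Sup K = v\<close> \<open>Inf K = u\<close> by (simp add: mult_ac)
    qed
    then have "(\<Sum>K\<in>d. norm (prod (p (Sup K)) (q (Sup K)) - prod (p (Inf K)) (q (Inf K))))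
        \<le> C * P * (\<Sum>K\<in>d. norm (q (Sup K) - q (Inf K))) + C * Q * (\<Sum>K\<in>d. norm (p (Sup K) - p (Inf K)))"
      unfolding sum_distrib_left sum.distrib[symmetric] by (rule sum_mono)
    also have "\<dots> < C * P * (\<epsilon> / (2 * C * P)) + C * Q * (\<epsilon> / (2 * C * Q))"
      by (intro add_strict_mono mult_strict_left_mono \<delta>1 \<delta>2) (use d P Q C in auto)
    also have "\<dots> = \<epsilon>"
      using P(1) Q(1) C(1) by (simp add: field_simps)
    finally show "(\<Sum>K\<in>d. norm (prod (p (Sup K)) (q (Sup K)) - prod (p (Inf K)) (q (Inf K)))) < \<epsilon>" .
  qed (use \<open>\<delta>1 > 0\<close> \<open>\<delta>2 > 0\<close> in auto)
qed

lemma bounded_bilinear_matrix_vector_mult: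
  "bounded_bilinear ((*v) :: real^'n^'m \<Rightarrow> real^'n \<Rightarrow> real^'m)"
  unfolding bilinear_conv_bounded_bilinear[symmetric] bilinear_def
  by (auto intro!: linearI simp: algebra_simps scaleR_matrix_vector_assoc)

lemma bounded_bilinear_vector_matrix_mult:
  "bounded_bilinear ((v*) :: real^'m \<Rightarrow> real^'n^'m \<Rightarrow> real^'n)"
  unfolding bilinear_conv_bounded_bilinear[symmetric] bilinear_def
  by (auto intro!: linearI simp: algebra_simps scaleR_vector_matrix_assoc vector_scaleR_matrix_ac)

section \<open>Backward uniqueness for linear differential inequalities\<close>

text \<open>A Gronwall argument run backwards from a zero at \<open>T\<close>, with a coefficient
  \<open>b\<close> that is only integrable. Zeros propagate to the left over short intervals, and
  finitely many of these reach 0. Applied to \<open>A t *v v\<close>, this will show that the kernel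
  of the fundamental matrix is trivial.\<close>

lemma abs_continuous_eq_0_backward:
  fixes y :: "real \<Rightarrow> 'a::banach"
  assumes AC: "abs_continuous_on_interval 0 T y"
    and N: "negligible N"
    and deriv: "\<And>t. t \<in> {0..T} - N \<Longrightarrow> (y has_vector_derivative \<phi> t) (at t)"
    and bound: "\<And>t. t \<in> {0..T} - N \<Longrightarrow> norm (\<phi> t) \<le> b t * norm (y t)"
    and b: "b integrable_on {0..T}" "\<And>t. t \<in> {0..T} \<Longrightarrow> 0 \<le> b t"
    and "0 \<le> T" "y T = 0"
  shows "y 0 = 0"
proof -
  define F where "F t = integral {0..t} b" for t
  have "continuous_on {0..T} F"
    unfolding F_def by (rule indefinite_integral_continuous_1[OF b(1)])
  then have "uniformly_continuous_on {0..T} F"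
    by (rule compact_uniformly_continuous) simp
  then obtain \<delta> where "\<delta> > 0"
      and \<delta>: "\<And>s t. \<lbrakk>s \<in> {0..T}; t \<in> {0..T}; \<bar>s - t\<bar> < \<delta>\<rbrakk> \<Longrightarrow> \<bar>F s - F t\<bar> < 1/2"
    unfolding uniformly_continuous_on_def dist_real_def by (metis half_gt_zero_iff zero_less_one)
  \<comment> \<open>If \<open>y\<close> vanishes at the right end of an interval on which \<open>b\<close> has integral below 1/2,
    the maximum \<open>M\<close> of its norm there satisfies \<open>M \<le> M/2\<close>.\<close>
  have step: "y s = 0" if "y c = 0" "c \<in> {0..T}" "s \<in> {0..c}" "c - s < \<delta>" for c s
  proof -
    have "continuous_on {s..c} (\<lambda>t. norm (y t))"
      by (intro continuous_on_norm continuous_on_subset[OF abs_continuous_on_imp_continuous_on[OF AC]])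
        (use that in auto)
    moreover have "s \<le> c" using that by simp
    ultimately obtain m where m: "m \<in> {s..c}" and max: "\<And>t. t \<in> {s..c} \<Longrightarrow> norm (y t) \<le> norm (y m)"
      using continuous_attains_sup[of "{s..c}" "\<lambda>t. norm (y t)"] by auto
    have sub: "{m..c} \<subseteq> {0..T}" using m that by auto
    have "(\<phi> has_integral y c - y m) {m..c}"
    proof (rule has_integral_if_abs_continuous[OF _ abs_continuous_on_subinterval[OF AC sub] N])
      show "m \<le> c" using m by simp
      show "(y has_vector_derivative \<phi> t) (at t within {m..c})" if "t \<in> {m..c} - N" for t
        by (rule has_vector_derivative_at_within[OF deriv]) (use that sub in auto)
    qed
    \<comment> \<open>The bound on \<phi> holds only off \<open>N\<close>; setting the integrand to
      0 on \<open>N\<close> makes it hold at every point of the interval.\<close>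
    then have \<phi>: "((\<lambda>t. if t \<in> N then 0 else \<phi> t) has_integral y c - y m) {m..c}"
      by (rule has_integral_spike[OF N, rotated]) auto
    have b': "b integrable_on {m..c}"
      by (rule integrable_subinterval_real[OF b(1) sub])
    have "norm (y m) = norm (integral {m..c} (\<lambda>t. if t \<in> N then 0 else \<phi> t))"
      using integral_unique[OF \<phi>] \<open>y c = 0\<close> by simp
    also have "\<dots> \<le> integral {m..c} (\<lambda>t. b t * norm (y m))"
    proof (rule integral_norm_bound_integral)
      show "(\<lambda>t. if t \<in> N then 0 else \<phi> t) integrable_on {m..c}" using \<phi> by blast
      show "(\<lambda>t. b t * norm (y m)) integrable_on {m..c}"
        using integrable_on_mult_left[OF b'] by simp
      fix t assume t: "t \<in> {m..c}"
      show "norm (if t \<in> N then 0 else \<phi> t) \<le> b t * norm (y m)"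
      proof (cases "t \<in> N")
        case True
        then show ?thesis using b(2)[of t] t sub by auto
      next
        case False
        then have "norm (\<phi> t) \<le> b t * norm (y t)" using bound t sub by auto
        also have "\<dots> \<le> b t * norm (y m)"
          using max[of t] b(2)[of t] t m sub by (intro mult_left_mono) auto
        finally show ?thesis using False by simp
      qed
    qed
    also have "\<dots> = (F c - F m) * norm (y m)"
    proof -
      have "b integrable_on {0..c}"
        using integrable_subinterval_real[OF b(1), of 0 c] that by auto
      from Henstock_Kurzweil_Integration.integral_combine[OF _ _ this, of m] show ?thesis
        using m that by (simp add: F_def)
    qed
    also have "\<dots> \<le> 1/2 * norm (y m)"
    proof (rule mult_right_mono)
      have "\<bar>F c - F m\<bar> < 1/2" using \<delta>[of c m] m that by auto
      then show "F c - F m \<le> 1/2" by linarith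
    qed simp
    finally have "norm (y m) = 0" by simp
    then show "y s = 0" using max[of s] that by simp
  qed
  \<comment> \<open>Steps of length \<open>\<delta>/2\<close> satisfy the strict inequality demanded
    by \<open>step\<close>, and \<open>max 0\<close> stops the descent at the left end
    point.\<close>
  have "y (max 0 (T - real n * (\<delta>/2))) = 0" for n
  proof (induction n)
    case 0
    then show ?case using \<open>0 \<le> T\<close> \<open>y T = 0\<close> by simp
  next
    case (Suc n)
    define w where "w = real n * (\<delta>/2)"
    have "real (Suc n) * (\<delta>/2) = w + \<delta>/2" and "w \<ge> 0"
      using \<open>\<delta> > 0\<close> by (simp_all add: w_def algebra_simps)
    moreover have "y (max 0 (T - (w + \<delta>/2))) = 0"
      by (rule step[OF Suc[folded w_def]])
        (use \<open>0 \<le> T\<close> \<open>\<delta> > 0\<close> \<open>w \<ge> 0\<close> in \<open>simp_all add: max_def\<close>)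
    ultimately show ?case by (simp only:)
  qed
  moreover obtain n where "real n * (\<delta>/2) > T"
    using reals_Archimedean3[of "\<delta>/2"] \<open>\<delta> > 0\<close> by auto
  moreover have "max 0 (T - real n * (\<delta>/2)) = 0" using calculation(2) by simp
  ultimately show ?thesis by metis
qed

section \<open>Gradients and the state derivative of the Hamiltonian\<close>

lemma gradient_eqI:
  assumes "GDERIV h x :> D"
  shows "gradient h x = D"
  unfolding gradient_def
proof (rule the_equality)
  show "GDERIV h x :> D" by (rule assms)
next
  fix D' assume "GDERIV h x :> D'"
  then have "(\<lambda>v. v \<bullet> D') = (\<lambda>v. v \<bullet> D)"
    using assms unfolding gderiv_def by (rule has_derivative_unique)
  then have "(D' - D) \<bullet> (D' - D) = 0"
    by (simp add: inner_diff_right fun_eq_iff)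
  then show "D' = D"
    by simp
qed

lemma GDERIV_gradient:
  fixes h :: "'a::euclidean_space \<Rightarrow> real"
  assumes "h differentiable (at x)"
  shows "GDERIV h x :> gradient h x"
proof -
  obtain h' where h': "(h has_derivative h') (at x)"
    using assms by (auto simp: differentiable_def)
  then have "linear h'" by (rule has_derivative_linear)
  \<comment> \<open>\<open>adjoint h' 1\<close> is the Riesz representative of the linear functional
    \<open>h'\<close>.\<close>
  then have "h' = (\<lambda>v. v \<bullet> adjoint h' 1)"
    by (simp add: adjoint_works)
  with h' have "GDERIV h x :> adjoint h' 1"
    unfolding gderiv_def by simp
  then show ?thesis using gradient_eqI by metis
qed

text \<open>This exhibits the adjoint equation as an affine linear equation for the row vector
  \<psi>. Moving the Jacobian across the inner product turns its action on columns into the action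
  \<open>v*\<close> on rows.\<close>

lemma gradient_hamiltonian:
  assumes f: "(\<lambda>y. f t y u) differentiable (at x)" and g: "(\<lambda>y. g t y u) differentiable (at x)"
  shows "gradient (\<lambda>y. hamiltonian f g y t u l \<psi>) x = \<psi> v* f_x f t x u + l *\<^sub>R g_x g t x u"
proof (rule gradient_eqI, unfold gderiv_def hamiltonian_def)
  have "((\<lambda>y. f t y u) has_derivative (\<lambda>v. f_x f t x u *v v)) (at x)"
    using f jacobian_works unfolding f_x_def by blast
  moreover have "((\<lambda>y. g t y u) has_derivative (\<lambda>v. v \<bullet> g_x g t x u)) (at x)"
    using GDERIV_gradient[OF g] unfolding gderiv_def g_x_def .
  ultimately have "((\<lambda>y. \<psi> \<bullet> f t y u + l * g t y u) has_derivative
      (\<lambda>v. \<psi> \<bullet> (f_x f t x u *v v) + l * (v \<bullet> g_x g t x u))) (at x)"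
    by (intro has_derivative_add has_derivative_inner_right has_derivative_mult_right)
  then show "((\<lambda>y. \<psi> \<bullet> f t y u + l * g t y u) has_derivative
      (\<lambda>v. v \<bullet> (\<psi> v* f_x f t x u + l *\<^sub>R g_x g t x u))) (at x)"
    by (simp add: inner_add_right dot_lmul_matrix[symmetric] inner_commute)
qed

section \<open>Adjoint solutions and the fundamental matrix\<close>

text \<open>The set \<open>S\<close> is kept general so that the identity serves both the limit
  pair, on the half-line, and the approximating pairs, on finite intervals. For \<open>l = 1\<close>
  the \<open>has_integral\<close> form also supplies the integrability needed to split the integral
  in \<open>I_fun\<close>.\<close>

lemma adjoint_solution_has_integral:
  assumes diff: "\<And>t x u. t \<ge> 0 \<Longrightarrow>
      (\<lambda>y. f t y u) differentiable (at x) \<and> (\<lambda>y. g t y u) differentiable (at x)"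
    and A: "fundamental_matrix f x0 u0 A"
    and \<psi>: "locally_AC \<psi>" "adjoint_equation f g x0 u0 S l \<psi>"
    and T: "0 \<le> T" "{0..T} \<subseteq> S"
  shows "((\<lambda>t. l *\<^sub>R (g_x g t (x0 t) (u0 t) v* A t)) has_integral \<psi> 0 - \<psi> T v* A T) {0..T}"
proof -
  let ?F = "\<lambda>t. f_x f t (x0 t) (u0 t)" and ?G = "\<lambda>t. g_x g t (x0 t) (u0 t)"
  have A0: "A 0 = mat 1" and AAC: "locally_AC A"
    and Ader: "AE t in lebesgue. t \<ge> 0 \<longrightarrow> (A has_vector_derivative ?F t ** A t) (at t)"
    using A unfolding fundamental_matrix_def by auto
  from Ader \<psi>(2)[unfolded adjoint_equation_def] have "AE t in lebesgue. t \<in> {0..T} \<longrightarrow> ((\<lambda>s. \<psi> s v* A s) has_vector_derivative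
      - (l *\<^sub>R (?G t v* A t))) (at t)"
  proof eventually_elim
    case (elim t)
    show ?case
    proof
      assume t: "t \<in> {0..T}"
      then have "(\<psi> has_vector_derivative - (\<psi> t v* ?F t + l *\<^sub>R ?G t)) (at t)"
        using elim(2) T(2) gradient_hamiltonian[of f t "u0 t" "x0 t" g] diff by auto
      moreover have "(A has_vector_derivative ?F t ** A t) (at t)"
        using elim(1) t by simp
      ultimately have "((\<lambda>s. \<psi> s v* A s) has_vector_derivative
          \<psi> t v* (?F t ** A t) + - (\<psi> t v* ?F t + l *\<^sub>R ?G t) v* A t) (at t)"
        by (rule bounded_bilinear.has_vector_derivative[OF bounded_bilinear_vector_matrix_mult])
      \<comment> \<open>The term from the derivative of \<open>A\<close> cancels the Jacobian part
        of the derivative of \<psi>, leaving only the contribution of \<open>g\<close>. The negated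
        row vector is treated as a difference from 0.\<close>
      moreover have "\<psi> t v* (?F t ** A t) + - (\<psi> t v* ?F t + l *\<^sub>R ?G t) v* A t = - (l *\<^sub>R (?G t v* A t))"
        using vector_matrix_mult_diff_distrib[of 0 "\<psi> t v* ?F t + l *\<^sub>R ?G t" "A t"]
        by (simp add: vector_matrix_left_distrib vector_matrix_mul_assoc scaleR_vector_matrix_assoc)
      ultimately show "((\<lambda>s. \<psi> s v* A s) has_vector_derivative - (l *\<^sub>R (?G t v* A t))) (at t)"
        by simp
    qed
  qed
  then obtain N where N: "negligible N"
    and deriv: "\<And>t. t \<in> {0..T} - N \<Longrightarrow>
      ((\<lambda>s. \<psi> s v* A s) has_vector_derivative - (l *\<^sub>R (?G t v* A t))) (at t)"
    unfolding eventually_ae_filter_negligible by blast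
  have "abs_continuous_on_interval 0 T (\<lambda>s. \<psi> s v* A s)"
    using \<psi>(1) AAC T(1) unfolding locally_AC_def
    by (intro bounded_bilinear.abs_continuous_on_interval[OF bounded_bilinear_vector_matrix_mult]) auto
  from has_integral_if_abs_continuous[OF T(1) this N has_vector_derivative_at_within, OF deriv]
  show ?thesis
    using has_integral_neg A0 by force
qed

text \<open>If \<open>A T *v v = 0\<close>, then \<open>A t *v v\<close> solves a linear equation
  and vanishes at \<open>T\<close>, hence also at 0, where it equals \<open>v\<close>. A square
  matrix with trivial kernel is invertible.\<close>

lemma fundamental_matrix_invertible:
  fixes f :: "real \<Rightarrow> real^'n \<Rightarrow> 'u::euclidean_space \<Rightarrow> real^'n"
  assumes bounded: "integrally_bounded_on_compacts U (f_x f)"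
    and u0: "\<And>t. t \<ge> 0 \<Longrightarrow> u0 t \<in> U t"
    and x0: "locally_AC x0"
    and A: "fundamental_matrix f x0 u0 A"
    and T: "0 \<le> T"
  shows "invertible (A T)"
proof -
  let ?F = "\<lambda>t. f_x f t (x0 t) (u0 t)"
  have A0: "A 0 = mat 1" and AAC: "abs_continuous_on_interval 0 T A"
    and AE: "AE t in lebesgue. t \<ge> 0 \<longrightarrow> (A has_vector_derivative ?F t ** A t) (at t)"
    using A T unfolding fundamental_matrix_def locally_AC_def by auto
  obtain N where N: "negligible N"
    and deriv: "\<And>t. t \<in> {0..T} - N \<Longrightarrow> (A has_vector_derivative ?F t ** A t) (at t)"
    using AE unfolding eventually_ae_filter_negligible by fastforce
  \<comment> \<open>The trajectory stays in a compact set up to time \<open>T\<close>, so the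
    integral bound for compacts yields one coefficient \<open>b\<close> dominating the Jacobian
    along it.\<close>
  have "compact (x0 ` {0..T})"
    using x0 T unfolding locally_AC_def
    by (intro compact_continuous_image abs_continuous_on_imp_continuous_on) auto
  then obtain b where b: "locally_integrable b"
    and Fb: "\<And>t. t \<in> {0..T} \<Longrightarrow> norm (?F t) \<le> b t"
    using bounded u0 unfolding integrally_bounded_on_compacts_def by fastforce
  obtain C where C: "C > 0" "\<And>M (v::real^'n). norm (M *v v) \<le> norm (M::real^'n^'n) * norm v * C"
    using bounded_bilinear.pos_bounded[OF bounded_bilinear_matrix_vector_mult] by blast
  have "v = 0" if "A T *v v = 0" for v
  proof -
    have "A 0 *v v = 0"
    proof (rule abs_continuous_eq_0_backward[where y = "\<lambda>t. A t *v v" and b = "\<lambda>t. C * b t"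
          and \<phi> = "\<lambda>t. ?F t *v (A t *v v)", OF _ N])
      show "abs_continuous_on_interval 0 T (\<lambda>t. A t *v v)"
        by (intro bounded_bilinear.abs_continuous_on_interval[OF bounded_bilinear_matrix_vector_mult]
            AAC abs_continuous_on_const)
      show "((\<lambda>t. A t *v v) has_vector_derivative ?F t *v (A t *v v)) (at t)" if "t \<in> {0..T} - N" for t
        using bounded_bilinear.has_vector_derivative[OF bounded_bilinear_matrix_vector_mult
            deriv[OF that] has_vector_derivative_const[of v]]
        by (simp add: matrix_vector_mul_assoc)
      show "norm (?F t *v (A t *v v)) \<le> C * b t * norm (A t *v v)" if "t \<in> {0..T} - N" for t
      proof -
        have "norm (?F t *v (A t *v v)) \<le> norm (?F t) * norm (A t *v v) * C"
          by (rule C(2))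
        also have "\<dots> \<le> b t * norm (A t *v v) * C"
          using Fb[of t] that C(1) by (intro mult_right_mono) auto
        finally show ?thesis by (simp add: mult_ac)
      qed
      show "(\<lambda>t. C * b t) integrable_on {0..T}"
        using b T unfolding locally_integrable_def
        by (intro integrable_on_mult_right set_lebesgue_integral_eq_integral(1)) auto
      show "0 \<le> C * b t" if "t \<in> {0..T}" for t
        using order_trans[OF norm_ge_zero Fb[OF that]] C(1) by simp
    qed (use T that in auto)
    then show "v = 0" by (simp add: A0)
  qed
  then show ?thesis
    using matrix_left_invertible_ker[of "A T"] invertible_left_inverse[of "A T"] by blast
qed

section \<open>Passage to the limit and the explicit formula\<close>

theorem mainTheorem4:
  fixes U :: "real \<Rightarrow> 'u::euclidean_space set"
    and f :: "real \<Rightarrow> real^'n \<Rightarrow> 'u \<Rightarrow> real^'n"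
    and g :: "real \<Rightarrow> real^'n \<Rightarrow> 'u \<Rightarrow> real"
    and xs :: "real^'n"
    and \<tau> :: "nat \<Rightarrow> real"
    and u0 :: "real \<Rightarrow> 'u"
    and x0 :: "real \<Rightarrow> real^'n"
    and l0 :: real
    and \<psi>0 :: "real \<Rightarrow> real^'n"
    and A :: "real \<Rightarrow> real^'n^'n"
    and Istar :: "real^'n"
  assumes "standing_assumptions U f g"
    and "\<forall>n. \<tau> n > 0" and "incseq \<tau>" and "filterlim \<tau> at_top sequentially"
    and "strictly_optimal U f g xs \<tau> u0"
    and "trajectory f xs u0 x0"
    and "strictly_vanishing U f g x0 u0 \<tau> l0 \<psi>0"
    and "normalization_condition l0 \<psi>0"
    and "fundamental_matrix f x0 u0 A"
    and "(\<lambda>n. I_fun g x0 u0 A (\<tau> n)) \<longlonglongrightarrow> Istar"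
  shows "l0 = 1 \<and> \<psi>0 0 = Istar \<and>
     (\<forall>T\<ge>0. \<psi>0 T = (Istar - I_fun g x0 u0 A T) v* matrix_inv (A T) \<and>
        (Istar - I_fun g x0 u0 A T) v* matrix_inv (A T) =
          (Istar - integral {0..T} (\<lambda>t. g_x g t (x0 t) (u0 t) v* A t)) v* matrix_inv (A T)) \<and>
     ((\<exists>L. (I_fun g x0 u0 A \<longlongrightarrow> L) at_top) \<longrightarrow>
        (\<forall>T\<ge>0. \<exists>V. ((\<lambda>S. integral {T..S} (\<lambda>t. g_x g t (x0 t) (u0 t) v* A t)) \<longlongrightarrow> V) at_top \<and>
           \<psi>0 T = V v* matrix_inv (A T)))"
proof -
  let ?k = "\<lambda>t. g_x g t (x0 t) (u0 t) v* A t" and ?I = "I_fun g x0 u0 A"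
  have diff: "\<And>t x u. t \<ge> 0 \<Longrightarrow>
      (\<lambda>y. f t y u) differentiable (at x) \<and> (\<lambda>y. g t y u) differentiable (at x)"
    and bounded: "integrally_bounded_on_compacts U (f_x f)"
    using assms(1) unfolding standing_assumptions_def regular_map_def by auto
  have u0: "\<And>t. t \<ge> 0 \<Longrightarrow> u0 t \<in> U t"
    using assms(5) unfolding strictly_optimal_def admissible_controls_def by auto
  have x0: "locally_AC x0"
    using assms(6) unfolding trajectory_def by auto
  have integral: "((\<lambda>t. l *\<^sub>R ?k t) has_integral \<psi> 0 - \<psi> T v* A T) {0..T}"
    if "mp_solution_on U f g x0 u0 S l \<psi>" "0 \<le> T" "{0..T} \<subseteq> S" for S l \<psi> T
    using that unfolding mp_solution_on_def
    by (intro adjoint_solution_has_integral[OF diff assms(9)]) auto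
  have mp0: "mp_solution_on U f g x0 u0 {0..} l0 \<psi>0"
    using assms(7) unfolding strictly_vanishing_def by simp
  obtain r l \<psi> where r: "strict_mono r"
    and mp: "\<forall>n. mp_solution_on U f g x0 u0 {0..\<tau> (r n)} (l n) (\<psi> n) \<and> \<psi> n (\<tau> (r n)) = 0"
    and l: "l \<longlonglongrightarrow> l0"
    and unif: "\<forall>K. compact K \<and> K \<subseteq> {0..} \<longrightarrow> uniform_limit K \<psi> \<psi>0 sequentially"
    using assms(7)[unfolded strictly_vanishing_def] by (elim conjE exE) (rule that; assumption)
  \<comment> \<open>At the time \<open>\<tau> (r n)\<close> the boundary term vanishes together with
    \<open>\<psi> n\<close>, so only the initial value remains.\<close>
  have "\<psi> n 0 = l n *\<^sub>R ?I (\<tau> (r n))" for n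
    using integral_unique[OF integral[OF mp[THEN spec, THEN conjunct1], of "\<tau> (r n)" n]] assms(2) mp
    by (simp add: I_fun_def less_imp_le)
  moreover have "(\<lambda>n. l n *\<^sub>R ?I (\<tau> (r n))) \<longlonglongrightarrow> l0 *\<^sub>R Istar"
    using LIMSEQ_subseq_LIMSEQ[OF assms(10) r] by (intro tendsto_scaleR l) (simp add: o_def)
  \<comment> \<open>Uniform convergence on the compact set \<open>{0}\<close> is convergence of the
    initial values.\<close>
  moreover have "(\<lambda>n. \<psi> n 0) \<longlonglongrightarrow> \<psi>0 0"
    by (rule tendsto_uniform_limitI[OF unif[rule_format, of "{0}"]]) auto
  ultimately have init: "\<psi>0 0 = l0 *\<^sub>R Istar"
    using LIMSEQ_unique by simp
  then have "l0 = 1"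
    using assms(8) unfolding normalization_condition_def by auto
  have k: "(?k has_integral Istar - \<psi>0 T v* A T) {0..T}" if "T \<ge> 0" for T
    using integral[OF mp0 that] init \<open>l0 = 1\<close> by simp
  have formula: "\<psi>0 T = (Istar - ?I T) v* matrix_inv (A T)" if "T \<ge> 0" for T
  proof -
    have "invertible (A T)"
      by (rule fundamental_matrix_invertible[OF bounded u0 x0 assms(9) that])
    \<comment> \<open>\<open>matrix_inv\<close> is a choice among two-sided inverses; invertibility
      ensures that the chosen matrix is one.\<close>
    then have "A T ** matrix_inv (A T) = mat 1"
      unfolding invertible_def matrix_inv_def by (metis (mono_tags, lifting) someI_ex)
    moreover have "\<psi>0 T v* A T = Istar - ?I T"
      using integral_unique[OF k[OF that]] by (simp add: I_fun_def)
    ultimately show ?thesis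
      by (metis vector_matrix_mul_assoc vector_matrix_mul_rid)
  qed
  \<comment> \<open>A limit of \<open>I_fun\<close> at infinity must agree with its limit along
    \<tau>, which is \<open>Istar\<close>. The improper integral over the tail is therefore the row
    vector already found in \<open>formula\<close>.\<close>
  have "((\<lambda>S. integral {T..S} ?k) \<longlongrightarrow> Istar - ?I T) at_top"
    if L: "(?I \<longlongrightarrow> L) at_top" and T: "T \<ge> 0" for L T
  proof -
    have "(\<lambda>n. ?I (\<tau> n)) \<longlonglongrightarrow> L"
      by (rule filterlim_compose[OF L assms(4)])
    then have "L = Istar"
      using assms(10) LIMSEQ_unique by blast
    with L have "((\<lambda>S. ?I S - ?I T) \<longlongrightarrow> Istar - ?I T) at_top"
      by (intro tendsto_diff tendsto_const) simp
    moreover have "\<forall>\<^sub>F S in at_top. ?I S - ?I T = integral {T..S} ?k"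
      using eventually_ge_at_top[of T]
    proof eventually_elim
      case (elim S)
      have "?k integrable_on {0..S}" using k[of S] elim T by auto
      from Henstock_Kurzweil_Integration.integral_combine[OF T elim this]
      show ?case by (simp add: I_fun_def algebra_simps)
    qed
    ultimately show ?thesis
      by (rule Lim_transform_eventually)
  qed
  then show ?thesis
    using formula init \<open>l0 = 1\<close> by (auto simp: I_fun_def)
qed

end
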